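(* Let $A,H,B,K$ be logically independent events with $H\neq\emptyset$, $K\neq\emptyset$, and let $(x,y)$ be any coherent assessment on $\{A|H,\,B|K\}$, i.e. $P(A|H)=x$, $P(B|K)=y$. Then the extension $z=\mathbb{P}[(A|H)\wedge(B|K)]$ is coherent (that is, the assessment $(x,y,z)$ on $\{A|H,\,B|K,\,(A|H)\wedge(B|K)\}$ is coherent) if and only if $$\max\{x+y-1,0\}\ \le\ z\ \le\ \min\{x,y\}.$$
   Context: Events are identified with their indicators (value 1 if true, 0 if false); $\emptyset$ is the impossible event, $H^c$ the negation of $H$, juxtaposition denotes conjunction (product of indicators). Four events are logically independent if all $2^4$ conjunctions obtained by taking each event or its negation are different from $\emptyset$. A finite random quantity is a real quantity with finitely many possible values (a finitely-valued real function of the possible outcomes). For an event $H\neq\emptyset$ and a finite random quantity $X$ with assessed conditional prevision $\mathbb{P}(X|H)=\mu\in\mathbb{R}$, the conditional random quantity $X|H$ is the random quantity $X|H = XH+\mu H^c$. In particular, for an event $A$ with $P(A|H)=x$ one has $A|H=AH+xH^c$. Conjunction: given $P(A|H)=x$, $P(B|K)=y$, the conjunction of the conditional events $A|H$ and $B|K$ is the conditional random quantity $(A|H)\wedge(B|K)=\min\{A|H,B|K\}\,|\,(H\vee K)$, where $A|H=AH+xH^c$ and $B|K=BK+yK^c$. Thus if its prevision is $z$, it takes the value $1$ if $AHBK$ is true, $0$ if $A^cH\vee B^cK$ is true, $x$ if $H^cBK$ is true, $y$ if $AHK^c$ is true, and $z$ if $H^cK^c$ is true. Coherence: a real function $\mathbb{P}$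 on a family $\mathcal{K}$ of finite conditional random quantities is coherent iff for all $n\ge1$, all $X_1|H_1,\dots,X_n|H_n\in\mathcal{K}$ and all real $s_1,\dots,s_n$, setting $\mu_i=\mathbb{P}(X_i|H_i)$ and $\mathcal{G}=\sum_{i=1}^n s_iH_i(X_i-\mu_i)$, the minimum and maximum of the values of $\mathcal{G}$ over the outcomes where $H_1\vee\cdots\vee H_n$ is true satisfy $\min\mathcal{G}\le 0\le\max\mathcal{G}$. *)

theory Defs
  imports Complex_Main "HOL-Library.Indicator_Function"
begin

text \<open>
  Events are sets of outcomes and random quantities are real functions of the outcome.
  The conditional random quantity \<open>X|H\<close> is the pair \<open>(X, H)\<close>; its prevision is
  supplied separately by an assessment \<open>P\<close>, which is a total function of which only
  the values on the family under consideration matter.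
\<close>

type_synonym 'w rq = "'w \<Rightarrow> real"
type_synonym 'w cond_rq = "'w rq \<times> 'w set"

definition literal :: "'w set \<Rightarrow> bool \<Rightarrow> 'w set" where
  "literal E b = (if b then E else - E)"

definition logically_independent4 ::
    "'w set \<Rightarrow> 'w set \<Rightarrow> 'w set \<Rightarrow> 'w set \<Rightarrow> bool" where
  "logically_independent4 E1 E2 E3 E4 \<longleftrightarrow>
     (\<forall>b1 b2 b3 b4. literal E1 b1 \<inter> literal E2 b2 \<inter> literal E3 b3 \<inter> literal E4 b4 \<noteq> {})"

definition finite_cond_rq :: "'w cond_rq \<Rightarrow> bool" where
  "finite_cond_rq C \<longleftrightarrow> finite (range (fst C)) \<and> snd C \<noteq> {}"

text \<open>The random quantity \<open>X H + \<mu> H\<^sup>c\<close> that \<open>X|H\<close> denotes once its prevision is \<open>\<mu>\<close>.\<close>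

definition cond_value :: "'w cond_rq \<Rightarrow> real \<Rightarrow> 'w rq" where
  "cond_value C \<mu> \<omega> =
     fst C \<omega> * indicator (snd C) \<omega> + \<mu> * indicator (- snd C) \<omega>"

definition cond_event :: "'w set \<Rightarrow> 'w set \<Rightarrow> 'w cond_rq" where
  "cond_event A H = (indicator A, H)"

text \<open>The conjunction depends on the assessed values \<open>x = P(A|H)\<close> and \<open>y = P(B|K)\<close>.\<close>

definition cond_conj ::
    "'w set \<Rightarrow> 'w set \<Rightarrow> real \<Rightarrow> 'w set \<Rightarrow> 'w set \<Rightarrow> real \<Rightarrow> 'w cond_rq" where
  "cond_conj A H x B K y =
     ((\<lambda>\<omega>. min (cond_value (cond_event A H) x \<omega>) (cond_value (cond_event B K) y \<omega>)), H \<union> K)"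

definition gain ::
    "('w cond_rq \<Rightarrow> real) \<Rightarrow> nat \<Rightarrow> (nat \<Rightarrow> 'w cond_rq) \<Rightarrow> (nat \<Rightarrow> real) \<Rightarrow> 'w rq" where
  "gain P n C s \<omega> =
     (\<Sum>i=1..n. s i * indicator (snd (C i)) \<omega> * (fst (C i) \<omega> - P (C i)))"

text \<open>
  The first conjunct is the standing requirement on the family; it ensures that
  \<open>Min\<close> and \<open>Max\<close> below are taken over finite nonempty sets.
\<close>

definition coherent :: "('w cond_rq \<Rightarrow> real) \<Rightarrow> 'w cond_rq set \<Rightarrow> bool" where
  "coherent P F \<longleftrightarrow>
     (\<forall>C\<in>F. finite_cond_rq C) \<and>
     (\<forall>n\<ge>1. \<forall>C s. (\<forall>i\<in>{1..n}. C i \<in> F) \<longrightarrow>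
        (let V = gain P n C s ` (\<Union>i\<in>{1..n}. snd (C i))
         in Min V \<le> 0 \<and> 0 \<le> Max V))"

text \<open>
  The three conditional random quantities are different pairs, so that an assessment may
  take arbitrary values on them.
\<close>

lemma cond_rqs_distinct:
  assumes "logically_independent4 A H B K"
  shows "distinct [cond_event A H, cond_event B K, cond_conj A H x B K y]"
proof -
  have "literal A True \<inter> literal H True \<inter> literal B True \<inter> literal K False \<noteq> {}"
    "literal A True \<inter> literal H False \<inter> literal B True \<inter> literal K True \<noteq> {}"
    using assms unfolding logically_independent4_def by blast+
  then show ?thesis
    by (auto simp: literal_def cond_event_def cond_conj_def)
qed

end

theory Submission
  imports Defs
begin

text \<open>
  Necessity and sufficiency are dual. If one of the bounds fails, then a combination of bets
  with coefficients \<open>\<plusminus>1\<close> has a gain of at least some positive constant whenever some bet is on.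
  Single bets show in this way that \<open>x\<close> and \<open>y\<close> lie in the unit interval. The other
  combinations come from the inequalities \<open>max (a + b - 1) 0 \<le> min a b \<le> a, b\<close> for \<open>a, b\<close> in
  that interval, applied to the values \<open>a\<close> of \<open>A|H\<close> and \<open>b\<close> of \<open>B|K\<close>:
  a bet on \<open>X|H\<close> pays the value of \<open>X|H\<close> minus its prevision (lemma \<open>payoff_eq\<close>), also when
  \<open>H\<close> is false, so that every linear inequality that holds between the three conditional
  random quantities on \<open>H \<union> K\<close> passes to their previsions.

  Conversely, if the bounds hold, then \<open>z\<close>, \<open>x - z\<close>, \<open>y - z\<close> and \<open>1 - x - y + z\<close> form a
  probability distribution. Placed on the four constituents inside \<open>H \<inter> K\<close>, it makes \<open>A\<close>
  and \<open>B\<close> events of probability \<open>x\<close> and \<open>y\<close> whose conjunction has probability \<open>z\<close>. Under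
  this distribution every bet is on with certainty and fair, hence every combination of bets
  has expected gain zero, and a gain of expectation zero can be neither always positive nor always negative
  (lemma \<open>coherent_if_fair_distribution\<close>). Logical independence is what makes all four
  constituents available.
\<close>

section \<open>Gains as combinations of payoffs\<close>

text \<open>
  Finiteness makes \<open>Min\<close> and \<open>Max\<close> of the values of the gain genuine extrema; without it they
  would be unspecified values.
\<close>

lemma finite_range_gain:
  assumes "\<And>i. i \<in> {1..n} \<Longrightarrow> finite_cond_rq (C i)"
  shows "finite (range (gain P n C s))"
  using assms
proof (induction n)
  case 0
  have "gain P 0 C s = (\<lambda>_. 0)"
    by (simp add: gain_def fun_eq_iff)
  then show ?case
    by simp
next
  case (Suc n)
  let ?D = "C (Suc n)"
  let ?h = "\<lambda>(g, u, v). g + s (Suc n) * u * (v - P ?D)"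
  have "finite (range (fst ?D))"
    using Suc.prems by (simp add: finite_cond_rq_def)
  moreover have "finite (range (gain P n C s))"
    using Suc by simp
  moreover have "range (gain P (Suc n) C s)
      \<subseteq> ?h ` (range (gain P n C s) \<times> {0, 1} \<times> range (fst ?D))"
  proof (rule image_subsetI)
    fix \<omega>
    have "gain P (Suc n) C s \<omega> = ?h (gain P n C s \<omega>, indicator (snd ?D) \<omega>, fst ?D \<omega>)"
      by (simp add: gain_def)
    moreover have "indicator (snd ?D) \<omega> \<in> {0, 1 :: real}"
      by (simp add: indicator_def)
    ultimately show "gain P (Suc n) C s \<omega>
        \<in> ?h ` (range (gain P n C s) \<times> {0, 1} \<times> range (fst ?D))"
      by blast
  qed
  ultimately show ?case
    by (meson finite.emptyI finite_SigmaI finite_imageI finite_insert finite_subset)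
qed

lemma cond_value_on_condition: "\<omega> \<in> snd C \<Longrightarrow> cond_value C \<mu> \<omega> = fst C \<omega>"
  by (simp add: cond_value_def)

text \<open>Setting the value of \<open>X|H\<close> outside \<open>H\<close> to the prevision encodes that the bet is called off.\<close>

lemma payoff_eq:
  "indicator (snd C) \<omega> * (fst C \<omega> - P C) = cond_value C (P C) \<omega> - P C"
  by (simp add: cond_value_def indicator_def)

lemma gain_eq_sum_cond_value:
  "gain P n C s \<omega> = (\<Sum>i=1..n. s i * (cond_value (C i) (P (C i)) \<omega> - P (C i)))"
  by (simp add: gain_def mult.assoc payoff_eq)

section \<open>Necessity: bets that would win for sure\<close>

lemma coherent_gain_lower_bound:
  assumes coh: "coherent P F" and n: "n \<ge> 1"
    and C: "\<And>i. i \<in> {1..n} \<Longrightarrow> C i \<in> F"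
    and c: "\<And>\<omega>. \<omega> \<in> (\<Union>i\<in>{1..n}. snd (C i)) \<Longrightarrow> c \<le> gain P n C s \<omega>"
  shows "c \<le> 0"
proof -
  define V where "V = gain P n C s ` (\<Union>i\<in>{1..n}. snd (C i))"
  have fin: "finite_cond_rq (C i)" if "i \<in> {1..n}" for i
    using coh C[OF that] by (simp add: coherent_def)
  have "finite V"
    unfolding V_def by (rule finite_subset[OF _ finite_range_gain[OF fin]]) auto
  moreover have "V \<noteq> {}"
    using fin[of 1] n by (auto simp: V_def finite_cond_rq_def)
  ultimately have "c \<le> Min V"
    using c by (auto simp: V_def)
  moreover have "Min V \<le> 0"
    using coh n C unfolding coherent_def V_def Let_def by blast
  ultimately show ?thesis
    by linarith
qed

text \<open>
  A single bet on \<open>D\<close> says more than a combination in which the other coefficients vanish: the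
  latter also counts outcomes outside \<open>snd D\<close> where another bet is on. There the gain is zero,
  so that no positive lower bound could hold.
\<close>

lemma coherent_single:
  assumes "coherent P F" "D \<in> F"
    and "\<And>\<omega>. \<omega> \<in> snd D \<Longrightarrow> c \<le> t * (fst D \<omega> - P D)"
  shows "c \<le> 0"
  by (rule coherent_gain_lower_bound[where P = P and F = F and n = 1 and C = "\<lambda>_. D" and s = "\<lambda>_. t"])
    (use assms in \<open>auto simp: gain_def\<close>)

lemma coherent_cond_event_bounds:
  assumes "coherent P F" "cond_event A H \<in> F"
  shows "0 \<le> P (cond_event A H)" "P (cond_event A H) \<le> 1"
  using coherent_single[OF assms, of "- P (cond_event A H)" 1]
    coherent_single[OF assms, of "P (cond_event A H) - 1" "-1"]
  by (auto simp: cond_event_def indicator_def)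

lemma coherent_triple:
  assumes coh: "coherent P F" and F: "D1 \<in> F" "D2 \<in> F" "D3 \<in> F"
    and c: "\<And>\<omega>. \<omega> \<in> snd D1 \<union> snd D2 \<union> snd D3 \<Longrightarrow>
      c \<le> t1 * (cond_value D1 (P D1) \<omega> - P D1) + t2 * (cond_value D2 (P D2) \<omega> - P D2)
        + t3 * (cond_value D3 (P D3) \<omega> - P D3)"
  shows "c \<le> 0"
proof -
  let ?C = "\<lambda>i :: nat. if i = 1 then D1 else if i = 2 then D2 else D3"
  let ?s = "\<lambda>i :: nat. if i = 1 then t1 else if i = 2 then t2 else t3"
  have I: "{1..3 :: nat} = {1, 2, 3}"
    by auto
  show ?thesis
  proof (rule coherent_gain_lower_bound[OF coh])
    show "1 \<le> (3 :: nat)"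
      by simp
    show "?C i \<in> F" for i
      using F by simp
    show "c \<le> gain P 3 ?C ?s \<omega>" if "\<omega> \<in> (\<Union>i\<in>{1..3}. snd (?C i))" for \<omega>
      using c[of \<omega>] that unfolding gain_eq_sum_cond_value I by (simp add: add.assoc)
  qed
qed

text \<open>
  On \<open>H \<union> K\<close> the conjunction is the minimum \<open>min a b\<close> of the values of the two conditional
  events, and each bound on its prevision is a linear bound on \<open>min a b\<close>.
  Outside \<open>H \<union> K\<close> the conjunction takes the value \<open>z\<close> that is to be bounded, but these outcomes
  do not count, because all bets are called off there.
\<close>

lemma frechet_bounds_if_coherent:
  fixes A H B K :: "'w set"
  assumes coh: "coherent P F"
    and F: "cond_event A H \<in> F" "cond_event B K \<in> F" "cond_conj A H x B K y \<in> F"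
    and P: "P (cond_event A H) = x" "P (cond_event B K) = y" "P (cond_conj A H x B K y) = z"
  shows "max (x + y - 1) 0 \<le> z \<and> z \<le> min x y"
proof -
  define a where "a = cond_value (cond_event A H) x"
  define b where "b = cond_value (cond_event B K) y"
  have xy: "0 \<le> x" "x \<le> 1" "0 \<le> y" "y \<le> 1"
    using coherent_cond_event_bounds[OF coh] F P by metis+
  have conj: "cond_value (cond_conj A H x B K y) z \<omega> = min (a \<omega>) (b \<omega>)" if "\<omega> \<in> H \<union> K" for \<omega>
    using that by (subst cond_value_on_condition) (simp_all add: cond_conj_def a_def b_def)
  have ab: "0 \<le> a \<omega>" "a \<omega> \<le> 1" "0 \<le> b \<omega>" "b \<omega> \<le> 1" for \<omega>
    using xy by (auto simp: a_def b_def cond_value_def cond_event_def indicator_def)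
  have transfer: "c \<le> 0"
    if "\<And>\<omega>. c \<le> t1 * (a \<omega> - x) + t2 * (b \<omega> - y) + t3 * (min (a \<omega>) (b \<omega>) - z)" for c t1 t2 t3
  proof (rule coherent_triple[OF coh F])
    fix \<omega>
    assume "\<omega> \<in> snd (cond_event A H) \<union> snd (cond_event B K) \<union> snd (cond_conj A H x B K y)"
    then have "\<omega> \<in> H \<union> K"
      by (auto simp: cond_event_def cond_conj_def)
    then show "c \<le> t1 * (cond_value (cond_event A H) (P (cond_event A H)) \<omega> - P (cond_event A H))
        + t2 * (cond_value (cond_event B K) (P (cond_event B K)) \<omega> - P (cond_event B K))
        + t3 * (cond_value (cond_conj A H x B K y) (P (cond_conj A H x B K y)) \<omega>
            - P (cond_conj A H x B K y))"
      using that[of \<omega>] by (simp add: P conj a_def b_def)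
  qed
  have "z - x \<le> 0"
    by (rule transfer[where ?t1.0 = 1 and ?t2.0 = 0 and ?t3.0 = "-1"]) simp
  moreover have "z - y \<le> 0"
    by (rule transfer[where ?t1.0 = 0 and ?t2.0 = 1 and ?t3.0 = "-1"]) simp
  moreover have "- z \<le> 0"
    by (rule transfer[where ?t1.0 = 0 and ?t2.0 = 0 and ?t3.0 = 1]) (use ab in simp)
  moreover have "x + y - 1 - z \<le> 0"
  proof (rule transfer[where ?t1.0 = "-1" and ?t2.0 = "-1" and ?t3.0 = 1])
    fix \<omega>
    show "x + y - 1 - z \<le> -1 * (a \<omega> - x) + -1 * (b \<omega> - y) + 1 * (min (a \<omega>) (b \<omega>) - z)"
      using ab[of \<omega>] by (simp add: min_def)
  qed
  ultimately show ?thesis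
    by simp
qed

section \<open>Sufficiency: a distribution that makes every bet fair\<close>

text \<open>
  Averaging bounds the minimum of the gain above and its maximum below by the expected gain, which
  vanishes. The outcomes carrying the distribution lie in every conditioning event, so they belong
  to the outcomes over which the extrema are taken, whichever bets are chosen. The
  distribution is given by the weights \<open>p\<close> of points \<open>w i\<close> indexed by a finite set, so the
  points may coincide.
\<close>

lemma coherent_if_fair_distribution:
  fixes p :: "'i \<Rightarrow> real" and w :: "'i \<Rightarrow> 'w"
  assumes fin: "\<And>D. D \<in> F \<Longrightarrow> finite_cond_rq D"
    and p: "\<And>i. i \<in> I \<Longrightarrow> 0 \<le> p i" "(\<Sum>i\<in>I. p i) = 1"
    and w: "\<And>i D. i \<in> I \<Longrightarrow> D \<in> F \<Longrightarrow> w i \<in> snd D"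
    and fair: "\<And>D. D \<in> F \<Longrightarrow> (\<Sum>i\<in>I. p i * fst D (w i)) = P D"
  shows "coherent P F"
proof -
  have "Min V \<le> 0 \<and> 0 \<le> Max V"
    if n: "n \<ge> 1" and C: "\<forall>j\<in>{1..n}. C j \<in> F"
      and V: "V = gain P n C s ` (\<Union>j\<in>{1..n}. snd (C j))" for n C s V
  proof -
    have "finite V"
      unfolding V
      by (rule finite_subset[OF _ finite_range_gain[of n C P s]]) (use fin C in auto)
    moreover have "gain P n C s (w i) \<in> V" if "i \<in> I" for i
      using w[OF that, of "C 1"] C n unfolding V by force
    ultimately have bounds: "Min V \<le> gain P n C s (w i)" "gain P n C s (w i) \<le> Max V"
      if "i \<in> I" for i
      using that by simp_all
    have "(\<Sum>i\<in>I. p i * gain P n C s (w i))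
        = (\<Sum>i\<in>I. \<Sum>j=1..n. s j * (p i * fst (C j) (w i) - p i * P (C j)))"
      unfolding gain_def sum_distrib_left
      by (intro sum.cong refl) (use w C in \<open>simp add: algebra_simps\<close>)
    also have "\<dots> = (\<Sum>j=1..n. s j * ((\<Sum>i\<in>I. p i * fst (C j) (w i)) - (\<Sum>i\<in>I. p i) * P (C j)))"
      by (subst sum.swap) (simp add: sum_distrib_right sum_subtractf flip: sum_distrib_left)
    also have "\<dots> = 0"
      using fair C p(2) by simp
    finally have zero: "(\<Sum>i\<in>I. p i * gain P n C s (w i)) = 0" .
    have "Min V = (\<Sum>i\<in>I. p i * Min V)"
      by (simp add: p(2) flip: sum_distrib_right)
    also have "\<dots> \<le> 0"
      unfolding zero[symmetric] by (intro sum_mono mult_left_mono bounds p)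
    finally have "Min V \<le> 0" .
    have "0 \<le> (\<Sum>i\<in>I. p i * Max V)"
      unfolding zero[symmetric] by (intro sum_mono mult_left_mono bounds p)
    also have "\<dots> = Max V"
      by (simp add: p(2) flip: sum_distrib_right)
    finally show ?thesis
      using \<open>Min V \<le> 0\<close> by simp
  qed
  then show ?thesis
    using fin by (simp add: coherent_def Let_def)
qed

lemma finite_cond_rq_cond_event:
  assumes "H \<noteq> {}"
  shows "finite_cond_rq (cond_event A H)"
proof -
  have "range (indicator A :: 'a \<Rightarrow> real) \<subseteq> {0, 1}"
    by (auto simp: indicator_def)
  then show ?thesis
    using assms by (simp add: finite_cond_rq_def cond_event_def finite_subset)
qed

lemma finite_cond_rq_cond_conj:
  assumes "H \<noteq> {}"
  shows "finite_cond_rq (cond_conj A H x B K y)"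
proof -
  have val: "cond_value (cond_event E J) \<mu> \<omega> \<in> {0, 1, \<mu>}" for E J \<mu> and \<omega> :: 'a
    by (simp add: cond_value_def cond_event_def indicator_def)
  have "range (fst (cond_conj A H x B K y)) \<subseteq> (\<lambda>(a, b). min a b) ` ({0, 1, x} \<times> {0, 1, y})"
  proof (rule image_subsetI)
    fix \<omega>
    let ?ab = "(cond_value (cond_event A H) x \<omega>, cond_value (cond_event B K) y \<omega>)"
    have "?ab \<in> {0, 1, x} \<times> {0, 1, y}"
      using val by blast
    moreover have "fst (cond_conj A H x B K y) \<omega> = (\<lambda>(a, b). min a b) ?ab"
      by (simp add: cond_conj_def)
    ultimately show "fst (cond_conj A H x B K y) \<omega> \<in> (\<lambda>(a, b). min a b) ` ({0, 1, x} \<times> {0, 1, y})"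
      by (rule rev_image_eqI)
  qed
  then have "finite (range (fst (cond_conj A H x B K y)))"
    by (rule finite_subset) (intro finite_imageI finite_cartesian_product, simp_all)
  then show ?thesis
    using assms by (simp add: finite_cond_rq_def cond_conj_def)
qed

lemma coherent_if_frechet_bounds:
  fixes A H B K :: "'w set"
  assumes indep: "logically_independent4 A H B K"
    and P: "P (cond_event A H) = x" "P (cond_event B K) = y" "P (cond_conj A H x B K y) = z"
    and z: "max (x + y - 1) 0 \<le> z" "z \<le> min x y"
  shows "coherent P {cond_event A H, cond_event B K, cond_conj A H x B K y}"
proof -
  have "\<forall>i. \<exists>\<omega>. \<omega> \<in> literal A (fst i) \<inter> literal H True \<inter> literal B (snd i) \<inter> literal K True"
    using indep unfolding logically_independent4_def by blast
  then obtain w where "\<forall>i. w i \<in> literal A (fst i) \<inter> literal H True \<inter> literal B (snd i) \<inter> literal K True"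
    by metis
  then have w: "w i \<in> A \<longleftrightarrow> fst i" "w i \<in> B \<longleftrightarrow> snd i" "w i \<in> H" "w i \<in> K" for i
    by (drule_tac spec[where x = i], simp add: literal_def split: if_splits)+
  \<comment> \<open>The joint law of two events with probabilities \<open>x\<close> and \<open>y\<close> and joint probability \<open>z\<close>.\<close>
  define p where "p = (\<lambda>(u, v). if u then if v then z else x - z else if v then y - z else 1 - x - y + z)"
  have UNIV2: "UNIV = {(True, True), (True, False), (False, True), (False, False)}"
    by auto
  show ?thesis
  proof (rule coherent_if_fair_distribution[where I = UNIV and p = p and w = w])
    fix D
    assume D: "D \<in> {cond_event A H, cond_event B K, cond_conj A H x B K y}"
    have "H \<noteq> {}" "K \<noteq> {}"
      using w by auto
    then show "finite_cond_rq D"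
      using D by (auto intro: finite_cond_rq_cond_event finite_cond_rq_cond_conj)
    show "w i \<in> snd D" for i
      using D by (auto simp: cond_event_def cond_conj_def w simp del: split_paired_All)
    show "(\<Sum>i\<in>UNIV. p i * fst D (w i)) = P D"
    proof -
      consider "D = cond_event A H" | "D = cond_event B K" | "D = cond_conj A H x B K y"
        using D by blast
      then show ?thesis
        by cases (simp_all add: P, simp_all add: UNIV2 p_def w cond_event_def cond_conj_def cond_value_def)
    qed
  next
    show "0 \<le> p i" for i
      using z by (auto simp: p_def split: prod.splits)
    show "(\<Sum>i\<in>UNIV. p i) = 1"
      by (simp add: UNIV2 p_def)
  qed
qed

theorem theorem10:
  fixes A H B K :: "'w set" and x y z :: real and P :: "'w cond_rq \<Rightarrow> real"
  assumes "logically_independent4 A H B K"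
    and "H \<noteq> {}" and "K \<noteq> {}"
    and "P (cond_event A H) = x"
    and "P (cond_event B K) = y"
    and "coherent P {cond_event A H, cond_event B K}"
    and "P (cond_conj A H x B K y) = z"
  shows "coherent P {cond_event A H, cond_event B K, cond_conj A H x B K y} \<longleftrightarrow>
    max (x + y - 1) 0 \<le> z \<and> z \<le> min x y"
proof
  assume "coherent P {cond_event A H, cond_event B K, cond_conj A H x B K y}"
  then show "max (x + y - 1) 0 \<le> z \<and> z \<le> min x y"
    by (rule frechet_bounds_if_coherent[OF _ _ _ _ assms(4,5,7)]) simp_all
next
  assume "max (x + y - 1) 0 \<le> z \<and> z \<le> min x y"
  then show "coherent P {cond_event A H, cond_event B K, cond_conj A H x B K y}"
    by (intro coherent_if_frechet_bounds[OF assms(1,4,5,7)]) simp_all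
qed

end
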